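(* Let $(\alpha,\rho)\in\mathcal{A}$ and let $\mathfrak{f}_{\alpha,\rho}(z)=\int_{\mathbb{R}}e^{izx}\,\nu_{\alpha,\rho}(dx)$ be the characteristic function of the free stable distribution $\nu_{\alpha,\rho}$. Then for $z>0$ $$\mathfrak{f}_{\alpha,\rho}(z)=\sum_{n\ge0}(-1)^n\,\frac{e^{\pi i\alpha(1/2-\rho)n}}{n!\,\Gamma(2+(\alpha-1)n)}\,z^{\alpha n}.$$
   Context: The set of admissible parameters is $$\mathcal{A}=\{(\alpha,\rho):\alpha\in(0,1),\ \rho\in[0,1]\}\cup\{(\alpha,\rho):\alpha\in(1,2],\ \rho\in[1-\alpha^{-1},\alpha^{-1}]\}.$$ All powers use the principal branch. For $(\alpha,\rho)\in\mathcal{A}$, the free stable distribution $\nu_{\alpha,\rho}$ is the probability measure on $\mathbb{R}$ (known to exist and be unique) whose Voiculescu transform is $\phi_{\alpha,\rho}(z)=-e^{\pi i\alpha\rho}z^{-\alpha+1}$ for $\operatorname{Im}(z)>0$. This means that its Cauchy transform $G_{\alpha,\rho}(z)=\int_{\mathbb{R}}\frac{\nu_{\alpha,\rho}(dx)}{z-x}$, $\operatorname{Im}(z)>0$ (which takes values in the lower half-plane), is the inverse function of $w\mapsto \frac1w+\phi_{\alpha,\rho}(\frac1w)$, i.e. $w=G_{\alpha,\rho}(z)$ satisfies $z=w^{-1}-e^{\pi i\alpha\rho}w^{\alpha-1}$ for all $z$ with $\operatorname{Im}(z)>0$. The reciprocal $1/\Gamma$ is the entire function, equal to $0$ at non-positive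 integers. *)

theory Defs
  imports "HOL-Probability.Probability" "HOL-Analysis.Gamma_Function"
begin

definition admissible :: "(real \<times> real) set" where
  "admissible =
     {(\<alpha>, \<rho>). \<alpha> \<in> {0<..<1} \<and> \<rho> \<in> {0..1}} \<union>
     {(\<alpha>, \<rho>). \<alpha> \<in> {1<..2} \<and> \<rho> \<in> {1 - inverse \<alpha>..inverse \<alpha>}}"

definition cauchy_transform :: "real measure \<Rightarrow> complex \<Rightarrow> complex" where
  "cauchy_transform \<nu> z = (CLINT x|\<nu>. 1 / (z - complex_of_real x))"

text \<open>
  The Voiculescu transform of \<open>\<nu>\<close> extends to \<open>\<phi>\<close> on the whole upper half-plane, i.e. the Cauchy
  transform of \<open>\<nu>\<close> is inverse to \<open>w \<mapsto> 1 / w + \<phi> (1 / w)\<close>. The equation speaks about \<open>\<phi>\<close> only on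
  the range of \<open>1 / cauchy_transform \<nu>\<close>, a nonempty open subset of the upper half-plane;
  holomorphy makes \<open>\<phi>\<close> unique on the rest of the half-plane.
\<close>
definition has_voiculescu_transform :: "real measure \<Rightarrow> (complex \<Rightarrow> complex) \<Rightarrow> bool" where
  "has_voiculescu_transform \<nu> \<phi> \<longleftrightarrow>
     \<phi> holomorphic_on {z. Im z > 0} \<and>
     (\<forall>z. Im z > 0 \<longrightarrow>
        (let w = cauchy_transform \<nu> z in 1 / w + \<phi> (1 / w) = z))"

definition stable_voiculescu :: "real \<Rightarrow> real \<Rightarrow> complex \<Rightarrow> complex" where
  "stable_voiculescu \<alpha> \<rho> z =
     - exp (complex_of_real pi * \<i> * of_real \<alpha> * of_real \<rho>) * z powr of_real (- \<alpha> + 1)"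

text \<open>
  For admissible parameters exactly one measure satisfies this predicate.
\<close>
definition free_stable_distribution :: "real \<Rightarrow> real \<Rightarrow> real measure \<Rightarrow> bool" where
  "free_stable_distribution \<alpha> \<rho> \<nu> \<longleftrightarrow>
     real_distribution \<nu> \<and> has_voiculescu_transform \<nu> (stable_voiculescu \<alpha> \<rho>)"

end

theory Submission
  imports Defs
begin

text \<open>
  The characteristic function and its claimed expansion have the same Laplace transform near
  infinity.

  For \<open>y > 0\<close> and the characteristic function \<open>f\<close>, Fubini gives, for the integral over \<open>t > 0\<close>,
  \<open>\<integral> e\<^bsup>-yt\<^esup> f(t) dt = \<integral> \<nu>(dx) / (y - \<i>x) = u(y) / y\<close>, where \<open>u(y)\<close> is the conjugate of \<open>\<i>y G(\<i>y)\<close>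
  (\<open>laplace_char\<close>). The equation that defines the free stable distribution becomes \<open>u = 1 + x u\<^sup>\<alpha>\<close> with
  \<open>x = - e\<^bsup>\<pi>\<i>\<alpha>(1/2-\<rho>)\<^esup> y\<^bsup>-\<alpha>\<^esup>\<close> (\<open>free_stable_functional_equation\<close>). As \<open>y\<close> tends to infinity, \<open>u(y)\<close> tends to \<open>1\<close>,
  and near \<open>1\<close> the equation has only one solution, the generalized binomial series \<open>u = \<Sum>n. a\<^sub>n x\<^sup>n\<close> with
  \<open>a\<^sub>n = (\<alpha>n choose (n - 1)) / n\<close> (\<open>raney_series_inverse\<close>). This case of Lagrange inversion reduces to
  the fact that a \<open>k\<close>-th finite difference annihilates polynomials of degree less than \<open>k\<close>
  (\<open>raney_convolution\<close>).

  On the other side, \<open>a\<^sub>n = \<Gamma>(\<alpha>n + 1) / (n! \<Gamma>(2 + (\<alpha> - 1) n))\<close>, and the Laplace transform of \<open>t\<^bsup>\<alpha>n\<^esup>\<close> is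
  \<open>\<Gamma>(\<alpha>n + 1) y\<^bsup>-\<alpha>n-1\<^esup>\<close>. Transforming the claimed expansion term by term therefore yields \<open>y\<^bsup>-1\<^esup> \<Sum>n. a\<^sub>n x\<^sup>n\<close>
  with the same \<open>x\<close>, again \<open>u(y) / y\<close> (\<open>laplace_stable_series\<close>). Both functions are continuous, so the
  uniqueness theorem for Laplace transforms (\<open>laplace_unique\<close>) identifies them for \<open>t > 0\<close>.
\<close>

section \<open>The generalized binomial series\<close>

text \<open>
  The \<open>k\<close>-th finite difference kills polynomials of degree below \<open>k\<close>. For monomials the absorption
  identity turns a factor \<open>n\<close> of the summand into a shift of \<open>k\<close>, which drives the induction.
\<close>
lemma alternating_binomial_sum_power:
  "m < k \<Longrightarrow> (\<Sum>n\<le>k. (-1) ^ n * of_nat (k choose n) * of_nat n ^ m) = (0 :: 'a :: comm_ring_1)"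
proof (induction k arbitrary: m)
  case (Suc k)
  show ?case
  proof (cases m)
    case 0
    thus ?thesis using choose_alternating_sum[of "Suc k", where 'a = 'a] by simp
  next
    case (Suc m')
    have absorb: "of_nat (Suc k choose Suc n) * of_nat (Suc n) = (of_nat (Suc k) * of_nat (k choose n) :: 'a)" for n
      unfolding of_nat_mult [symmetric] by (subst mult.commute) (simp only: Suc_times_binomial)
    have "(\<Sum>n\<le>Suc k. (-1) ^ n * of_nat (Suc k choose n) * of_nat n ^ m) =
          (\<Sum>n\<le>k. (-1) ^ Suc n * (of_nat (Suc k choose Suc n) * of_nat (Suc n)) * of_nat (Suc n) ^ m' :: 'a)"
      by (subst sum.atMost_Suc_shift) (simp add: Suc algebra_simps del: binomial_Suc_Suc of_nat_Suc)
    also have "\<dots> = - of_nat (Suc k) * (\<Sum>n\<le>k. (-1) ^ n * of_nat (k choose n) * (of_nat n + 1) ^ m')"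
      unfolding absorb by (simp add: sum_distrib_left sum_negf algebra_simps)
    also have "(\<Sum>n\<le>k. (-1) ^ n * of_nat (k choose n) * (of_nat n + 1 :: 'a) ^ m') =
               (\<Sum>j\<le>m'. of_nat (m' choose j) * (\<Sum>n\<le>k. (-1) ^ n * of_nat (k choose n) * of_nat n ^ j))"
      unfolding binomial_ring sum_distrib_left
      by (subst sum.swap) (simp add: mult_ac)
    also have "\<dots> = 0"
      using Suc.prems Suc.IH Suc by (intro sum.neutral) auto
    finally show ?thesis by simp
  qed
qed simp

lemma alternating_binomial_sum_poly:
  fixes p :: "'a :: comm_ring_1 poly"
  assumes "degree p < k"
  shows "(\<Sum>n\<le>k. (-1) ^ n * of_nat (k choose n) * poly p (of_nat n)) = 0"
proof -
  have "(\<Sum>n\<le>k. (-1) ^ n * of_nat (k choose n) * poly p (of_nat n)) =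
        (\<Sum>m\<le>degree p. coeff p m * (\<Sum>n\<le>k. (-1) ^ n * of_nat (k choose n) * of_nat n ^ m))"
    unfolding poly_altdef sum_distrib_left
    by (subst sum.swap) (simp add: mult_ac)
  also have "\<dots> = 0"
    using assms by (intro sum.neutral) (auto simp: alternating_binomial_sum_power)
  finally show ?thesis .
qed

text \<open>
  These are the coefficients of the generalized binomial series (Fuss--Catalan numbers when \<open>\<alpha>\<close> is an
  integer), usually written \<open>(\<alpha> n choose n) / ((\<alpha> - 1) n + 1)\<close>. The form used here is the one that
  Lagrange inversion produces; it has no vanishing denominator when \<open>(\<alpha> - 1) n = - 1\<close>.
\<close>
definition raney :: "real \<Rightarrow> nat \<Rightarrow> real" where
  "raney \<alpha> n = (if n = 0 then 1 else (\<alpha> * real n gchoose (n - 1)) / real n)"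

text \<open>
  The Gamma quotient \<open>\<Gamma>(\<alpha>n + 1) / \<Gamma>(2 + (\<alpha> - 1) n)\<close> is a product of \<open>n - 1\<close> factors if \<open>n \<ge> 1\<close>, because
  the two arguments differ by the integer \<open>n - 1\<close>. Stated with \<open>rGamma\<close>, the identity survives at the
  poles of \<open>\<Gamma>(2 + (\<alpha> - 1) n)\<close>. It relates a coefficient of the characteristic function to the
  coefficient of its Laplace transform.
\<close>
lemma raney_eq_Gamma:
  assumes "\<alpha> > 0"
  shows "raney \<alpha> n = Gamma (\<alpha> * real n + 1) * rGamma (2 + (\<alpha> - 1) * real n) / fact n"
proof (cases n)
  case 0
  thus ?thesis by (simp add: raney_def rGamma_inverse_Gamma Gamma_numeral)
next
  case (Suc m)
  define a where "a = \<alpha> * real n"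
  have "rGamma (2 + (\<alpha> - 1) * real n) = pochhammer (2 + (\<alpha> - 1) * real n) m * rGamma (a + 1)"
    using pochhammer_rGamma[of "2 + (\<alpha> - 1) * real n" m] by (simp add: Suc a_def algebra_simps)
  moreover have "Gamma (a + 1) * rGamma (a + 1) = 1"
  proof -
    have "a + 1 > 0" using assms by (auto simp: a_def intro!: add_nonneg_pos)
    from Gamma_real_pos[OF this] show ?thesis by (simp add: rGamma_inverse_Gamma)
  qed
  moreover have "pochhammer (2 + (\<alpha> - 1) * real n) m = fact m * (a gchoose m)"
    unfolding gbinomial_pochhammer' by (simp add: a_def Suc algebra_simps)
  ultimately show ?thesis
    by (simp add: raney_def Suc a_def divide_simps)
qed

text \<open>
  Only some geometric bound matters: every factor of the product is at most \<open>2 n\<close> in absolute value,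
  and \<open>(2 n)\<^sup>n / n!\<close> is one term of the series of \<open>exp (2 n)\<close>.
\<close>
lemma abs_raney_le:
  assumes "0 \<le> \<alpha>" "\<alpha> \<le> 2"
  shows "\<bar>raney \<alpha> n\<bar> \<le> exp 2 ^ n"
proof (cases n)
  case (Suc m)
  have "\<bar>\<alpha> * real n gchoose m\<bar> = (\<Prod>i<m. \<bar>\<alpha> * real n - real i\<bar>) / fact m"
    by (simp add: gbinomial_prod_rev abs_prod atLeast0LessThan)
  also have "\<dots> \<le> (\<Prod>i<m. 2 * real n) / fact m"
  proof (intro divide_right_mono prod_mono conjI)
    fix i assume "i \<in> {..<m}"
    have "0 \<le> \<alpha> * real n" "\<alpha> * real n \<le> 2 * real n"
      using assms by (auto intro: mult_right_mono)
    with \<open>i \<in> {..<m}\<close> show "\<bar>\<alpha> * real n - real i\<bar> \<le> 2 * real n" by (auto simp: Suc)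
  qed auto
  finally have "\<bar>raney \<alpha> n\<bar> \<le> (2 * real n) ^ m / fact n"
    by (simp add: raney_def Suc divide_simps mult_ac)
  also have "\<dots> \<le> (2 * real n) ^ n / fact n"
    by (intro divide_right_mono power_increasing) (auto simp: Suc)
  also have "\<dots> \<le> exp (2 * real n)"
  proof -
    have e: "(\<lambda>i. (2 * real n) ^ i /\<^sub>R fact i) sums exp (2 * real n)" by (rule exp_converges)
    have "(\<Sum>i\<in>{n}. (2 * real n) ^ i /\<^sub>R fact i) \<le> (\<Sum>i. (2 * real n) ^ i /\<^sub>R fact i)"
      by (rule sum_le_suminf) (use e in \<open>auto simp: sums_iff\<close>)
    thus ?thesis using e by (simp add: sums_iff divide_inverse mult.commute)
  qed
  also have "\<dots> = exp 2 ^ n"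
    by (simp add: exp_of_nat2_mult)
  finally show ?thesis .
qed (simp add: raney_def)

text \<open>
  This is the coefficient identity behind the inversion of \<open>v \<mapsto> v (1 + v)\<^bsup>-\<alpha>\<^esup>\<close>. For \<open>k \<ge> 2\<close>, up to the
  factor \<open>(-1)\<^sup>n (k choose n)\<close> and a constant, the summand is a falling factorial that ends at \<open>\<alpha>n\<close> times
  a rising factorial that starts at \<open>\<alpha>n\<close>. Together they are one contiguous product, with \<open>\<alpha>n\<close> occurring
  twice: a polynomial in \<open>n\<close> of degree at most \<open>k - 1\<close>. The sum is thus a \<open>k\<close>-th finite difference of a
  polynomial of smaller degree.
\<close>
lemma raney_convolution:
  "(\<Sum>n\<le>k. raney \<alpha> n * (- (\<alpha> * real n) gchoose (k - n))) = (if k \<le> 1 then 1 else 0)"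
proof (cases "k \<le> 1")
  case True
  thus ?thesis by (cases k) (auto simp: raney_def)
next
  case False
  define p where "p = [:0, \<alpha>:] * (\<Prod>i<k-2. [:2 + real i, \<alpha> - 1:])"
  have "degree p \<le> degree [:0, \<alpha>:] + degree (\<Prod>i<k-2. [:2 + real i, \<alpha> - 1:])"
    unfolding p_def by (rule degree_mult_le)
  also have "degree (\<Prod>i<k-2. [:2 + real i, \<alpha> - 1:]) \<le> (\<Sum>i<k-2. degree [:2 + real i, \<alpha> - 1:])"
    using degree_prod_sum_le[of "{..<k-2}" "\<lambda>i. [:2 + real i, \<alpha> - 1:]"] by (simp add: o_def)
  also have "\<dots> \<le> (\<Sum>i<k-2. 1)" by (intro sum_mono) auto
  finally have deg: "degree p < k" using False by (auto split: if_splits)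
  have poly_p: "poly p (real n) = \<alpha> * real n * pochhammer (2 + (\<alpha> - 1) * real n) (k - 2)" for n
    by (simp add: p_def poly_prod pochhammer_prod atLeast0LessThan algebra_simps)
  have summand: "raney \<alpha> n * (- (\<alpha> * real n) gchoose (k - n)) =
              (-1) ^ k / fact k * ((-1) ^ n * real (k choose n) * poly p (real n))" if "n \<le> k" for n
  proof (cases n)
    case 0
    moreover have "(0 :: real) gchoose k = 0"
      using False by (cases k) auto
    ultimately show ?thesis using poly_p[of 0] by simp
  next
    case (Suc m)
    define a where "a = \<alpha> * real n"
    have 1: "(a gchoose m) = pochhammer (2 + (\<alpha> - 1) * real n) m / fact m"
      unfolding gbinomial_pochhammer' by (simp add: a_def Suc algebra_simps)
    have 2: "(- a gchoose (k - n)) = (-1) ^ (k - n) * pochhammer a (k - n) / fact (k - n)"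
      by (simp add: gbinomial_pochhammer)
    have 3: "pochhammer (2 + (\<alpha> - 1) * real n) m * pochhammer a (k - n) = a * pochhammer (2 + (\<alpha> - 1) * real n) (k - 2)"
    \<comment> \<open>For \<open>k = n\<close> the rising factorial is empty, and \<open>a\<close> is the last factor of the falling one.\<close>
    proof (cases "k = n")
      case True
      then obtain l where m: "m = Suc l" using False Suc by (cases m) auto
      show ?thesis unfolding m
        by (simp add: True Suc m pochhammer_Suc a_def algebra_simps)
    next
      case F: False
      then obtain l where l: "k - n = Suc l" using \<open>n \<le> k\<close> by (cases "k - n") auto
      hence k: "k - 2 = m + l" using Suc by simp
      show ?thesis unfolding l k pochhammer_product'
        by (simp add: pochhammer_rec Suc a_def algebra_simps)
    qed
    have 4: "real (k choose n) = fact k / (fact n * fact (k - n))"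
      using binomial_fact[OF that] by simp
    have 5: "(-1) ^ (k - n) = (-1 :: real) ^ k * (-1) ^ n"
      using that by (auto simp: minus_one_power_iff)
    have "raney \<alpha> n * (- (\<alpha> * real n) gchoose (k - n)) =
            (-1) ^ (k - n) * (pochhammer (2 + (\<alpha> - 1) * real n) m * pochhammer a (k - n)) / (fact n * fact (k - n))"
    proof -
      have "raney \<alpha> n = (a gchoose m) / real n" by (simp add: raney_def Suc a_def)
      thus ?thesis unfolding a_def [symmetric] 1 2 by (simp add: Suc mult_ac)
    qed
    also have "\<dots> = (-1) ^ k / fact k * ((-1) ^ n * real (k choose n) * poly p (real n))"
      unfolding 3 4 5 poly_p by (simp add: a_def)
    finally show ?thesis .
  qed
  have "(\<Sum>n\<le>k. raney \<alpha> n * (- (\<alpha> * real n) gchoose (k - n))) =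
        (-1) ^ k / fact k * (\<Sum>n\<le>k. (-1) ^ n * real (k choose n) * poly p (real n))"
    unfolding sum_distrib_left by (intro sum.cong) (auto simp: summand)
  thus ?thesis
    using False alternating_binomial_sum_poly[OF deg] by simp
qed

lemma abs_gbinomial_minus_le:
  assumes "0 \<le> \<alpha>" "\<alpha> \<le> 2"
  shows "\<bar>- (\<alpha> * real n) gchoose j\<bar> \<le> 2 ^ (2 * n + j)"
proof -
  have "\<bar>- (\<alpha> * real n) gchoose j\<bar> = pochhammer (\<alpha> * real n) j / fact j"
    using assms by (simp add: gbinomial_pochhammer abs_mult pochhammer_prod prod_nonneg)
  also have "\<dots> \<le> pochhammer (real (2 * n) + 1) j / fact j"
  proof (intro divide_right_mono)
    have "\<alpha> * real n \<le> 2 * real n" using assms by (intro mult_right_mono) auto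
    thus "pochhammer (\<alpha> * real n) j \<le> pochhammer (real (2 * n) + 1) j"
      unfolding pochhammer_prod using assms by (intro prod_mono) auto
  qed auto
  also have "\<dots> = real (2 * n + j) gchoose j"
    by (simp add: gbinomial_pochhammer')
  also have "\<dots> = real ((2 * n + j) choose j)"
    by (simp add: binomial_gbinomial)
  also have "\<dots> \<le> real (2 ^ (2 * n + j))"
    unfolding of_nat_le_iff by (rule binomial_le_pow2)
  finally show ?thesis by simp
qed

text \<open>
  On a small disc, \<open>\<Sum>n. raney \<alpha> n * x ^ n\<close> inverts \<open>v \<mapsto> v (1 + v)\<^bsup>-\<alpha>\<^esup>\<close>, shifted by one: this is Lagrange
  inversion for the equation \<open>u = 1 + x u\<^sup>\<alpha>\<close>. Expanding \<open>(1 + v)\<^bsup>-\<alpha>n\<^esup>\<close> by the binomial series gives a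
  double series, which is summed along rows and along antidiagonals; the antidiagonal sums are those
  of \<open>raney_convolution\<close>. The radius \<open>1 / 64\<close> makes the double series absolutely convergent: its terms
  are at most \<open>9\<^sup>n 2\<^bsup>2n+j\<^esup> 64\<^bsup>-(n+j)\<^esup>\<close>.
\<close>
lemma raney_series_inverse:
  fixes v :: complex
  assumes \<alpha>: "0 \<le> \<alpha>" "\<alpha> \<le> 2" and v: "norm v \<le> 1 / 64"
  shows "(\<lambda>n. of_real (raney \<alpha> n) * (v * (1 + v) powr - of_real \<alpha>) ^ n) sums (1 + v)"
proof -
  define g where "g = (\<lambda>n j. - (\<alpha> * real n) gchoose j)"
  define f where "f = (\<lambda>(n, j). complex_of_real (raney \<alpha> n) * of_real (g n j) * v ^ (n + j))"
  have exp2: "exp 2 \<le> (9 :: real)"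
  proof -
    have "exp (2 :: real) = exp 1 * exp 1" by (simp flip: exp_add)
    also have "\<dots> \<le> 3 * 3" using exp_le by (intro mult_mono) auto
    finally show ?thesis by simp
  qed
  have geometric: "((\<lambda>n. x ^ n) has_sum (1 / (1 - x))) UNIV" if "0 \<le> x" "x < 1" for x :: real
    using geometric_sums[of x] summable_geometric[of x] that
    by (intro norm_summable_imp_has_sum) auto
  have "(\<lambda>(n, j). (9 / 16) ^ n * (1 / 32) ^ j :: real) summable_on UNIV \<times> UNIV"
  proof (rule summable_on_SigmaI)
    show "((\<lambda>j. case (n, j) of (n, j) \<Rightarrow> (9 / 16) ^ n * (1 / 32 :: real) ^ j) has_sum ((9 / 16) ^ n * (1 / (1 - 1 / 32)))) UNIV"
      for n :: nat
      unfolding prod.case by (intro has_sum_cmult_right geometric) auto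
    have "(\<lambda>n. (9 / 16 :: real) ^ n) summable_on UNIV"
      using geometric[of "9 / 16"] by (auto simp: summable_on_def)
    thus "(\<lambda>n. (9 / 16) ^ n * (1 / (1 - 1 / 32)) :: real) summable_on UNIV"
      by (rule summable_on_cmult_left)
  qed auto
  have "(\<lambda>x. norm (f x)) summable_on UNIV \<times> UNIV"
  proof (rule summable_on_comparison_test)
    show "(\<lambda>(n, j). (9 / 16) ^ n * (1 / 32) ^ j :: real) summable_on UNIV \<times> UNIV" by fact
    fix x :: "nat \<times> nat"
    obtain n j where x: "x = (n, j)" by force
    have "norm (f x) = \<bar>raney \<alpha> n\<bar> * \<bar>g n j\<bar> * norm v ^ (n + j)"
      by (simp add: f_def x norm_mult norm_power)
    also have "\<dots> \<le> 9 ^ n * 2 ^ (2 * n + j) * (1 / 64) ^ (n + j)"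
    proof (intro mult_mono)
      show "\<bar>raney \<alpha> n\<bar> \<le> 9 ^ n"
        using abs_raney_le[OF \<alpha>, of n] power_mono[OF exp2, of n] by simp
    qed (use abs_gbinomial_minus_le[OF \<alpha>] v in \<open>auto simp: g_def intro!: power_mono\<close>)
    also have "\<dots> = (9 * 2\<^sup>2 * (1 / 64)) ^ n * (2 * (1 / 64)) ^ j"
      unfolding power_mult_distrib power_add power_mult by (simp only: mult_ac)
    also have "\<dots> = (9 / 16) ^ n * (1 / 32) ^ j"
      by simp
    finally show "norm (f x) \<le> (case x of (n, j) \<Rightarrow> (9 / 16) ^ n * (1 / 32) ^ j)" by (simp add: x)
  qed auto
  hence "f summable_on UNIV \<times> UNIV" by (rule abs_summable_summable)
  then obtain S where S: "(f has_sum S) (UNIV \<times> UNIV)" by (auto simp: summable_on_def)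

  have rows: "((\<lambda>n. of_real (raney \<alpha> n) * (v * (1 + v) powr - of_real \<alpha>) ^ n) has_sum S) UNIV"
  proof (rule has_sum_SigmaD[OF S])
    fix n :: nat
    have "norm v < 1" using v by simp
    from gen_binomial_complex[OF this, of "- (of_real \<alpha> * of_nat n)"]
    have "(\<lambda>j. of_real (g n j) * v ^ j) sums (1 + v) powr - (of_real \<alpha> * of_nat n)"
      by (simp add: g_def gbinomial_prod_rev)
    hence "(\<lambda>j. of_real (raney \<alpha> n) * v ^ n * (of_real (g n j) * v ^ j)) sums
             (of_real (raney \<alpha> n) * v ^ n * (1 + v) powr - (of_real \<alpha> * of_nat n))"
      by (rule sums_mult)
    moreover have "(1 + v) powr - (of_real \<alpha> * of_nat n) = ((1 + v) powr - of_real \<alpha>) ^ n"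
      by (cases "1 + v = 0")
         (use \<open>norm v < 1\<close> in \<open>auto simp: powr_def exp_of_nat_mult [symmetric] algebra_simps add_eq_0_iff\<close>)
    ultimately have "(\<lambda>j. f (n, j)) sums (of_real (raney \<alpha> n) * (v * (1 + v) powr - of_real \<alpha>) ^ n)"
      by (simp add: f_def power_add power_mult_distrib mult_ac)
    moreover have "(\<lambda>j. f (n, j)) summable_on UNIV"
      by (rule summable_on_SigmaD1[where A = UNIV and B = "\<lambda>_. UNIV"])
         (use \<open>f summable_on UNIV \<times> UNIV\<close> in \<open>auto simp: case_prod_unfold\<close>)
    ultimately show "((\<lambda>j. f (n, j)) has_sum of_real (raney \<alpha> n) * (v * (1 + v) powr - of_real \<alpha>) ^ n) UNIV"
      by (metis has_sum_imp_sums has_sum_infsum sums_unique2)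
  qed
  have "((\<lambda>(k, n). f (n, k - n)) has_sum S) (SIGMA k:UNIV. {..k})"
  proof -
    have "((\<lambda>(k, n). f (n, k - n)) has_sum S) (SIGMA k:UNIV. {..k}) \<longleftrightarrow> (f has_sum S) (UNIV \<times> UNIV)"
      by (rule has_sum_reindex_bij_witness[where i = "\<lambda>(n, j). (n + j, n)" and j = "\<lambda>(k, n). (n, k - n)"]) auto
    thus ?thesis using S by simp
  qed
  hence "((\<lambda>k. \<Sum>n\<le>k. f (n, k - n)) has_sum S) UNIV"
    by (rule has_sum_SigmaD) auto
  moreover have "(\<Sum>n\<le>k. f (n, k - n)) = (if k \<le> 1 then v ^ k else 0)" for k
  proof -
    have "(\<Sum>n\<le>k. f (n, k - n)) = of_real (\<Sum>n\<le>k. raney \<alpha> n * g n (k - n)) * v ^ k"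
      by (simp add: f_def sum_distrib_right)
    thus ?thesis by (simp add: g_def raney_convolution)
  qed
  ultimately have "((\<lambda>k. if k \<le> 1 then v ^ k else 0) has_sum S) UNIV" by simp
  moreover have "((\<lambda>k. if k \<le> 1 then v ^ k else 0) has_sum (1 + v)) UNIV"
    by (rule has_sum_finite_neutralI[of "{..1}"]) auto
  ultimately have "S = 1 + v" by (rule has_sum_unique)
  with rows show ?thesis by (auto intro: has_sum_imp_sums)
qed

section \<open>Uniqueness of Laplace transforms\<close>

text \<open>
  One-sided form of Lerch's theorem. After the substitution \<open>x = exp (- s)\<close> the hypothesis says that
  all moments of \<open>k s = exp (- Y s) h s\<close> vanish, so by Weierstrass \<open>k\<close> is orthogonal to every continuous
  function of \<open>exp (- s)\<close>. A bump supported where \<open>h\<close> is positive would then have a positive integral.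
\<close>
lemma laplace_unique_real:
  fixes h :: "real \<Rightarrow> real"
  assumes cont: "continuous_on {0<..} h"
    and int: "\<And>y. y \<ge> Y \<Longrightarrow> has_bochner_integral lborel (\<lambda>t. indicator {0<..} t * (exp (- y * t) * h t)) 0"
    and t: "t > 0"
  shows "h t \<le> 0"
proof (rule ccontr)
  assume "\<not> h t \<le> 0"
  hence "h t > 0" by simp
  have "isCont h t"
    using cont t by (simp add: continuous_on_eq_continuous_at)
  from order_tendstoD(1)[OF this[unfolded isCont_def] \<open>h t > 0\<close>]
  obtain d where d: "d > 0" "\<And>s. s \<noteq> t \<Longrightarrow> dist s t < d \<Longrightarrow> h s > 0"
    by (auto simp: eventually_at)
  define e where "e = min d (t / 2)"
  have e: "e > 0" "t - e > 0" "e \<le> d" using d t by (auto simp: e_def)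
  have pos: "h s > 0" if "t - e < s" "s < t + e" for s
    using d(2)[of s] that e \<open>h t > 0\<close> by (cases "s = t") (auto simp: dist_real_def)
  define k where "k = (\<lambda>s. indicator {0<..} s * (exp (- Y * s) * h s))"
  have k_int: "integrable lborel k"
    using int[of Y] by (simp add: k_def has_bochner_integral_iff)
  have moments: "has_bochner_integral lborel (\<lambda>s. exp (- s) ^ n * k s) 0" for n
  proof -
    have "(\<lambda>s. exp (- s) ^ n * k s) = (\<lambda>s. indicator {0<..} s * (exp (- (Y + real n) * s) * h s))"
      by (simp add: fun_eq_iff k_def exp_of_nat_mult [symmetric] exp_add [symmetric] algebra_simps exp_diff exp_minus field_simps)
    thus ?thesis using int[of "Y + real n"] by simp
  qed
  define b where "b = (\<lambda>x. max 0 ((x - exp (- (t + e))) * (exp (- (t - e)) - x)))"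
  have b_cont: "continuous_on S b" for S
    unfolding b_def by (intro continuous_intros)
  have b_int: "integrable lborel (\<lambda>s. b (exp (- s)) * k s)"
  proof (rule Bochner_Integration.integrable_bound)
    show "integrable lborel (\<lambda>s. 1 * k s)" using k_int by simp
    have "b \<in> borel_measurable borel" by (intro borel_measurable_continuous_onI b_cont)
    thus "(\<lambda>s. b (exp (- s)) * k s) \<in> borel_measurable lborel"
      using k_int by measurable
    have "norm (b (exp (- s)) * k s) \<le> norm (1 * k s)" for s
    proof (cases "s > 0")
      case True
      have unit: "\<bar>exp (- s) - exp (- u)\<bar> \<le> 1" if "u > 0" for u
      proof -
        have "exp (- s) < 1" "exp (- u) < 1" using True that by auto
        thus ?thesis using exp_gt_zero[of "- s"] exp_gt_zero[of "- u"] by linarith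
      qed
      have "(exp (- s) - exp (- (t + e))) * (exp (- (t - e)) - exp (- s)) \<le>
              \<bar>exp (- s) - exp (- (t + e))\<bar> * \<bar>exp (- s) - exp (- (t - e))\<bar>"
        by (metis abs_ge_self abs_minus_commute abs_mult)
      also have "\<dots> \<le> 1 * 1"
        using e t by (intro mult_mono unit) auto
      finally have "b (exp (- s)) \<le> 1" by (simp add: b_def)
      moreover have "b (exp (- s)) \<ge> 0" by (simp add: b_def)
      ultimately show ?thesis by (auto simp: abs_mult intro: mult_left_le_one_le)
    qed (simp add: k_def)
    thus "AE s in lborel. norm (b (exp (- s)) * k s) \<le> norm (1 * k s)" by simp
  qed
  have "\<bar>\<integral>s. b (exp (- s)) * k s \<partial>lborel\<bar> \<le> 0"
  proof (rule field_le_epsilon)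
    fix \<epsilon> :: real assume "\<epsilon> > 0"
    define C where "C = (\<integral>s. \<bar>k s\<bar> \<partial>lborel)"
    have "C \<ge> 0" by (simp add: C_def)
    define \<delta> where "\<delta> = \<epsilon> / (C + 1)"
    have "\<delta> > 0" using \<open>\<epsilon> > 0\<close> \<open>C \<ge> 0\<close> by (simp add: \<delta>_def)
    from Stone_Weierstrass_real_polynomial_function[OF compact_Icc b_cont this, of 0 1]
    obtain g where g: "real_polynomial_function g" "\<And>x. x \<in> {0..1} \<Longrightarrow> \<bar>b x - g x\<bar> < \<delta>"
      by blast
    obtain a N where a: "g = (\<lambda>x. \<Sum>i\<le>N. a i * x ^ i)"
      using g(1) unfolding real_polynomial_function_iff_sum by blast
    have "has_bochner_integral lborel (\<lambda>s. \<Sum>i\<le>N. a i * (exp (- s) ^ i * k s)) (\<Sum>i\<le>N. a i * 0)"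
      by (intro has_bochner_integral_sum has_bochner_integral_mult_right moments)
    hence gk: "has_bochner_integral lborel (\<lambda>s. g (exp (- s)) * k s) 0"
      by (simp add: a sum_distrib_right mult.assoc)
    have "\<bar>\<integral>s. b (exp (- s)) * k s \<partial>lborel\<bar> = \<bar>\<integral>s. b (exp (- s)) * k s - g (exp (- s)) * k s \<partial>lborel\<bar>"
      using b_int gk by (simp add: has_bochner_integral_iff)
    also have "\<dots> \<le> (\<integral>s. \<bar>b (exp (- s)) * k s - g (exp (- s)) * k s\<bar> \<partial>lborel)"
      by (rule integral_abs_bound)
    also have "\<dots> \<le> (\<integral>s. \<delta> * \<bar>k s\<bar> \<partial>lborel)"
    proof (rule integral_mono)
      show "integrable lborel (\<lambda>s. \<bar>b (exp (- s)) * k s - g (exp (- s)) * k s\<bar>)"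
        using b_int gk by (auto simp: has_bochner_integral_iff)
      show "integrable lborel (\<lambda>s. \<delta> * \<bar>k s\<bar>)" using k_int by auto
      show "\<bar>b (exp (- s)) * k s - g (exp (- s)) * k s\<bar> \<le> \<delta> * \<bar>k s\<bar>" for s
      proof (cases "s > 0")
        case True
        hence "\<bar>b (exp (- s)) - g (exp (- s))\<bar> \<le> \<delta>" by (intro less_imp_le g) auto
        thus ?thesis by (simp add: abs_mult mult_right_mono flip: left_diff_distrib)
      qed (simp add: k_def)
    qed
    also have "\<dots> = \<delta> * C" by (simp add: C_def)
    also have "\<dots> \<le> 0 + \<epsilon>" using \<open>C \<ge> 0\<close> \<open>\<epsilon> > 0\<close> by (simp add: \<delta>_def divide_simps)
    finally show "\<bar>\<integral>s. b (exp (- s)) * k s \<partial>lborel\<bar> \<le> 0 + \<epsilon>" .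
  qed
  hence "(\<integral>s. b (exp (- s)) * k s \<partial>lborel) = 0" by simp
  have b_supp: "b (exp (- s)) > 0 \<longleftrightarrow> t - e < s \<and> s < t + e" for s
  proof -
    have "exp (- (t + e)) < exp (- (t - e))" using e by simp
    have "b (exp (- s)) > 0 \<longleftrightarrow> (exp (- s) - exp (- (t + e))) * (exp (- (t - e)) - exp (- s)) > 0"
      by (auto simp: b_def)
    also have "\<dots> \<longleftrightarrow> exp (- s) > exp (- (t + e)) \<and> exp (- (t - e)) > exp (- s)"
      using \<open>exp (- (t + e)) < exp (- (t - e))\<close> unfolding zero_less_mult_iff by linarith
    also have "\<dots> \<longleftrightarrow> t - e < s \<and> s < t + e" by auto
    finally show ?thesis .
  qed
  have b_nonneg: "b x \<ge> 0" for x by (simp add: b_def)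
  have k_pos: "k s > 0" if "b (exp (- s)) > 0" for s
    using that pos[of s] e unfolding b_supp by (simp add: k_def)
  have "AE s in lborel. b (exp (- s)) * k s = 0"
  proof (subst integral_nonneg_eq_0_iff_AE[symmetric])
    have "b (exp (- s)) * k s \<ge> 0" for s
      using b_nonneg[of "exp (- s)"] k_pos[of s] by (cases "b (exp (- s)) = 0") auto
    thus "AE s in lborel. 0 \<le> b (exp (- s)) * k s" by simp
  qed (use b_int in \<open>auto intro: \<open>(\<integral>s. b (exp (- s)) * k s \<partial>lborel) = 0\<close>\<close>)
  hence "AE s in lborel. s \<notin> {t - e<..<t + e}"
  proof eventually_elim
    case (elim s)
    thus ?case using k_pos[of s] b_supp[of s] by auto
  qed
  hence "emeasure lborel {t - e<..<t + e} = 0"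
    by (subst (asm) AE_iff_null_sets[symmetric]) auto
  thus False using e by simp
qed

text \<open>
  The one-sided real statement applies to the real part of \<open>c (f - g)\<close> for the four units \<open>c\<close>.
\<close>
lemma laplace_unique:
  fixes f g :: "real \<Rightarrow> complex"
  assumes cont: "continuous_on {0<..} f" "continuous_on {0<..} g"
    and f: "\<And>y. y \<ge> Y \<Longrightarrow> has_bochner_integral lborel (\<lambda>t. indicator {0<..} t *\<^sub>R (exp (- y * t) *\<^sub>R f t)) (L y)"
    and g: "\<And>y. y \<ge> Y \<Longrightarrow> has_bochner_integral lborel (\<lambda>t. indicator {0<..} t *\<^sub>R (exp (- y * t) *\<^sub>R g t)) (L y)"
    and t: "t > 0"
  shows "f t = g t"
proof -
  have le: "Re (c * (f t - g t)) \<le> 0" for c :: complex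
  proof (rule laplace_unique_real[OF _ _ t])
    show "continuous_on {0<..} (\<lambda>t. Re (c * (f t - g t)))"
      by (intro continuous_intros cont)
    fix y assume "y \<ge> Y"
    from has_bochner_integral_diff[OF f[OF this] g[OF this]]
    have "has_bochner_integral lborel (\<lambda>t. Re (c * (indicator {0<..} t *\<^sub>R (exp (- y * t) *\<^sub>R f t) -
             indicator {0<..} t *\<^sub>R (exp (- y * t) *\<^sub>R g t)))) (Re (c * (L y - L y)))"
      by (intro has_bochner_integral_Re has_bochner_integral_mult_right)
    also have "(\<lambda>t. Re (c * (indicator {0<..} t *\<^sub>R (exp (- y * t) *\<^sub>R f t) -
             indicator {0<..} t *\<^sub>R (exp (- y * t) *\<^sub>R g t)))) =
             (\<lambda>t. indicator {0<..} t * (exp (- y * t) * Re (c * (f t - g t))))"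
      by (simp add: fun_eq_iff algebra_simps)
    finally show "has_bochner_integral lborel (\<lambda>t. indicator {0<..} t * (exp (- y * t) * Re (c * (f t - g t)))) 0"
      by simp
  qed
  from le[of 1] le[of "-1"] le[of \<i>] le[of "- \<i>"] show ?thesis
    by (auto simp: complex_eq_iff)
qed

section \<open>Laplace transforms of powers and of characteristic functions\<close>

text \<open>
  Keep only the part \<open>t \<ge> R\<close> of Euler's integral. With \<open>R\<close> free, this shows that \<open>\<Gamma>(\<alpha>n + 1)\<close> eventually
  exceeds every geometric sequence, which is all the growth needed below.
\<close>
lemma Gamma_ge_powr_exp:
  fixes a R :: real
  assumes "a \<ge> 0" "R > 0"
  shows "R powr a * exp (- R) \<le> Gamma (a + 1)"
proof (rule has_integral_le)
  have "((\<lambda>t. R powr a * exp (- 1 * t)) has_integral R powr a * (exp (- 1 * R) / 1)) {R..}"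
    by (intro has_integral_mult_right has_integral_exp_minus_to_infinity) auto
  thus "((\<lambda>t. if t \<in> {R..} then R powr a * exp (- 1 * t) else 0) has_integral R powr a * exp (- R)) {0..}"
    using assms by (subst has_integral_restrict) auto
  show "((\<lambda>t. t powr (a + 1 - 1) / exp t) has_integral Gamma (a + 1)) {0..}"
    by (rule Gamma_integral_real) (use assms in auto)
  show "(if t \<in> {R..} then R powr a * exp (- 1 * t) else 0) \<le> t powr (a + 1 - 1) / exp t"
    if "t \<in> {0..}" for t
    using assms by (auto simp: exp_minus divide_inverse intro!: mult_right_mono powr_mono2)
qed

text \<open>
  Since \<open>0 powr a = 0\<close> in all cases, the half-line \<open>{0<..}\<close> and the half-line \<open>{0..}\<close> give the same
  integrand.
\<close>
lemma laplace_powr: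
  fixes a y :: real
  assumes "a \<ge> 0" "y > 0"
  shows "has_bochner_integral lborel (\<lambda>t. indicator {0<..} t * (exp (- y * t) * t powr a))
           (Gamma (a + 1) / y powr (a + 1))"
proof -
  have "has_bochner_integral lborel (\<lambda>t. indicator {0..} t * t powr a / exp t) (Gamma (a + 1))"
  proof (rule has_bochner_integral_nn_integral)
    show "(\<integral>\<^sup>+ t. ennreal (indicator {0..} t * t powr a / exp t) \<partial>lborel) = ennreal (Gamma (a + 1))"
      using Gamma_conv_nn_integral_real[of "a + 1"] assms by simp
  qed (use assms in \<open>auto intro!: Gamma_real_nonneg\<close>)
  hence "has_bochner_integral lborel (\<lambda>t. indicator {0..} (0 + y * t) * (0 + y * t) powr a / exp (0 + y * t))
           (Gamma (a + 1) /\<^sub>R \<bar>y\<bar>)"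
    using assms by (subst (asm) lborel_has_bochner_integral_real_affine_iff[of y _ _ 0]) auto
  hence "has_bochner_integral lborel
           (\<lambda>t. (indicator {0..} (0 + y * t) * (0 + y * t) powr a / exp (0 + y * t)) * (1 / y powr a))
           (Gamma (a + 1) /\<^sub>R \<bar>y\<bar> * (1 / y powr a))"
    by (rule has_bochner_integral_mult_left)
  also have "(\<lambda>t. (indicator {0..} (0 + y * t) * (0 + y * t) powr a / exp (0 + y * t)) * (1 / y powr a)) =
             (\<lambda>t. indicator {0<..} t * (exp (- y * t) * t powr a))"
    using assms
    by (auto simp: fun_eq_iff indicator_def powr_mult exp_minus field_simps zero_le_mult_iff)
  also have "Gamma (a + 1) /\<^sub>R \<bar>y\<bar> * (1 / y powr a) = Gamma (a + 1) / y powr (a + 1)"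
    using assms by (simp add: powr_add field_simps)
  finally show ?thesis .
qed

lemma laplace_exp:
  fixes y x :: real
  assumes "y > 0"
  shows "has_bochner_integral lborel (\<lambda>t. indicator {0<..} t *\<^sub>R (exp (- y * t) *\<^sub>R iexp (t * x)))
           (1 / (of_real y - \<i> * of_real x))"
proof -
  define s where "s = complex_of_real y - \<i> * of_real x"
  have "Re s > 0" using assms by (simp add: s_def)
  hence [simp]: "s \<noteq> 0" by auto
  define F where "F = (\<lambda>t. - exp (- s * of_real t) / s)"
  have eq: "exp (- y * t) *\<^sub>R iexp (t * x) = exp (- s * of_real t)" for t
    by (simp add: s_def scaleR_conv_of_real exp_of_real [symmetric] exp_add [symmetric] algebra_simps)
  have "integrable lborel (\<lambda>t. indicator {0<..} t * (exp (- y * t) * t powr 0))"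
    using laplace_powr[of 0 y] assms by (auto simp: has_bochner_integral_iff)
  hence int: "integrable lborel (\<lambda>t. indicator {0<..} t *\<^sub>R (exp (- y * t) *\<^sub>R iexp (t * x)))"
    by (rule Bochner_Integration.integrable_bound) (auto simp: indicator_def)
  have "(LBINT t=ereal 0..\<infinity>. exp (- y * t) *\<^sub>R iexp (t * x)) = 0 - (- 1 / s)"
  proof (rule interval_integral_FTC_integrable)
    show "(F has_vector_derivative exp (- y * t) *\<^sub>R iexp (t * x)) (at t)" for t
      unfolding eq F_def
      by (rule has_vector_derivative_real_field[where f = "\<lambda>z. - exp (- s * z) / s"])
         (auto intro!: derivative_eq_intros)
    show "isCont (\<lambda>t. exp (- y * t) *\<^sub>R iexp (t * x)) t" for t
      by (intro continuous_intros)
    show "set_integrable lborel (einterval (ereal 0) \<infinity>) (\<lambda>t. exp (- y * t) *\<^sub>R iexp (t * x))"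
      using int by (simp add: set_integrable_def)
    have "(F \<longlongrightarrow> F 0) (at_right 0)"
      unfolding F_def by (intro tendsto_intros) auto
    thus "((F \<circ> real_of_ereal) \<longlongrightarrow> - 1 / s) (at_right (ereal 0))"
      by (simp add: ereal_tendsto_simps1 F_def)
    have "((\<lambda>t. exp (- (y * t)) / norm s) \<longlongrightarrow> 0) at_top"
      using assms by (intro tendsto_divide_zero) (auto intro!: filterlim_compose[OF exp_at_bot] filterlim_tendsto_pos_mult_at_top simp: filterlim_uminus_at_bot filterlim_ident)
    hence "(F \<longlongrightarrow> 0) at_top"
      by (rule Lim_null_comparison[rotated])
         (auto simp: F_def norm_divide s_def intro!: always_eventually)
    thus "((F \<circ> real_of_ereal) \<longlongrightarrow> 0) (at_left \<infinity>)"
      by (simp add: ereal_tendsto_simps1)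
  qed simp
  also have "(LBINT t=ereal 0..\<infinity>. exp (- y * t) *\<^sub>R iexp (t * x)) =
             (LINT t|lborel. indicator {0<..} t *\<^sub>R (exp (- y * t) *\<^sub>R iexp (t * x)))"
    by (simp add: interval_lebesgue_integral_def set_lebesgue_integral_def)
  finally show ?thesis using int by (simp add: has_bochner_integral_iff s_def)
qed

text \<open>
  By Fubini, the Laplace transform of the characteristic function is the Cauchy transform on the
  imaginary axis, up to a rotation and a conjugation. The half-line \<open>t > 0\<close> is paired with
  \<open>1 / (y - \<i>x)\<close>, the complex conjugate of \<open>1 / (y + \<i>x) = \<i> / (\<i>y - x)\<close>.
\<close>
lemma (in real_distribution) laplace_char:
  fixes y :: real
  assumes "y > 0"
  shows "has_bochner_integral lborel (\<lambda>t. indicator {0<..} t *\<^sub>R (exp (- y * t) *\<^sub>R char M t))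
           (CLINT x|M. 1 / (of_real y - \<i> * of_real x))"
proof -
  interpret pair_sigma_finite lborel M ..
  define f where "f = (\<lambda>t x. indicator {0<..} t *\<^sub>R (exp (- y * t) *\<^sub>R iexp (t * x)))"
  have iexp_int: "integrable M (\<lambda>x. iexp (t * x))" for t
    by (intro integrable_const_bound[of _ 1]) auto
  have meas [measurable]: "(\<lambda>(t, x). f t x) \<in> borel_measurable (lborel \<Otimes>\<^sub>M M)"
    unfolding f_def by measurable
  have "integrable lborel (\<lambda>t. indicator {0<..} t * (exp (- y * t) * t powr 0))"
    using laplace_powr[of 0 y] assms by (auto simp: has_bochner_integral_iff)
  moreover have "(\<lambda>t. indicator {0<..} t * (exp (- y * t) * t powr 0)) = (\<lambda>t. \<integral>x. norm (f t x) \<partial>M)"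
    using prob_space by (auto simp: f_def fun_eq_iff indicator_def)
  ultimately have int: "integrable (lborel \<Otimes>\<^sub>M M) (\<lambda>(t, x). f t x)"
  proof (intro Fubini_integrable)
    have "integrable M (f t)" for t
      unfolding f_def by (intro integrable_scaleR_right iexp_int)
    thus "AE t in lborel. integrable M (\<lambda>x. case (t, x) of (t, x) \<Rightarrow> f t x)" by simp
  qed auto
  have inner: "(\<integral>x. f t x \<partial>M) = indicator {0<..} t *\<^sub>R (exp (- y * t) *\<^sub>R char M t)" for t
    by (simp add: f_def char_def)
  have "(\<integral>t. (\<integral>x. f t x \<partial>M) \<partial>lborel) = (\<integral>x. (\<integral>t. f t x \<partial>lborel) \<partial>M)"
    using Fubini_integral[OF int] by simp
  also have "\<dots> = (CLINT x|M. 1 / (of_real y - \<i> * of_real x))"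
    using laplace_exp[OF assms] by (simp add: f_def has_bochner_integral_iff)
  finally show ?thesis
    using integrable_fst'[OF int] by (simp add: has_bochner_integral_iff inner)
qed

text \<open>
  This normalization selects the right solution of the functional equation: among all \<open>u\<close> that satisfy
  it, only one stays near \<open>1\<close> as \<open>y\<close> grows.
\<close>
lemma (in real_distribution) cauchy_transform_tendsto:
  "((\<lambda>y. of_real y * (CLINT x|M. 1 / (of_real y - \<i> * of_real x))) \<longlongrightarrow> 1) at_top"
proof -
  have "((\<lambda>y. CLINT x|M. of_real y * (1 / (of_real y - \<i> * of_real x))) \<longlongrightarrow> (CLINT x|M. 1)) at_top"
  proof (rule integral_dominated_convergence_at_top[where w = "\<lambda>_. 1"])
    show "\<forall>\<^sub>F y in at_top. AE x in M. norm (of_real y * (1 / (of_real y - \<i> * of_real x))) \<le> 1"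
      using eventually_gt_at_top[of 0]
    proof eventually_elim
      case (elim y)
      have "norm (of_real y * (1 / (of_real y - \<i> * of_real x))) \<le> 1" for x
        using abs_Re_le_cmod[of "of_real y - \<i> * of_real x"] elim by (simp add: norm_divide divide_simps)
      thus ?case by simp
    qed
    show "AE x in M. ((\<lambda>y. of_real y * (1 / (of_real y - \<i> * of_real x))) \<longlongrightarrow> 1) at_top"
    proof (rule AE_I2)
      fix x
      have "((\<lambda>y. 1 / (1 - \<i> * of_real x * of_real (inverse y))) \<longlongrightarrow> 1 / (1 - \<i> * of_real x * of_real 0)) at_top"
        by (intro tendsto_intros tendsto_inverse_0_at_top filterlim_ident) auto
      moreover have "\<forall>\<^sub>F y in at_top. 1 / (1 - \<i> * of_real x * of_real (inverse y)) = of_real y * (1 / (of_real y - \<i> * of_real x))"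
        using eventually_gt_at_top[of 0]
      proof eventually_elim
        case (elim y)
        have "of_real y - \<i> * of_real x = of_real y * (1 - \<i> * of_real x * of_real (inverse y))"
          using elim by (simp add: field_simps)
        thus ?case using elim by simp
      qed
      ultimately show "((\<lambda>y. of_real y * (1 / (of_real y - \<i> * of_real x))) \<longlongrightarrow> 1) at_top"
        by (simp add: tendsto_cong)
    qed
  qed auto
  thus ?thesis using prob_space by (simp only: integral_mult_right_zero) simp
qed

section \<open>The series of the free stable characteristic function\<close>

definition stable_coeff :: "real \<Rightarrow> nat \<Rightarrow> real" where
  "stable_coeff \<alpha> n = rGamma (2 + (\<alpha> - 1) * real n) / fact n"

lemma raney_eq_stable_coeff:
  assumes "\<alpha> > 0"
  shows "raney \<alpha> n = Gamma (\<alpha> * real n + 1) * stable_coeff \<alpha> n"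
  using raney_eq_Gamma[OF assms] by (simp add: stable_coeff_def)

lemma abs_stable_coeff_le:
  assumes "0 < \<alpha>" "\<alpha> \<le> 2" "R > 0"
  shows "\<bar>stable_coeff \<alpha> n\<bar> \<le> exp R * (exp 2 / R powr \<alpha>) ^ n"
proof -
  have "\<bar>stable_coeff \<alpha> n\<bar> * (R powr (\<alpha> * real n) * exp (- R)) \<le> \<bar>stable_coeff \<alpha> n\<bar> * Gamma (\<alpha> * real n + 1)"
    using assms by (intro mult_left_mono Gamma_ge_powr_exp) auto
  also have "\<dots> = \<bar>raney \<alpha> n\<bar>"
  proof -
    have "\<alpha> * real n + 1 > 0" using assms by (intro add_nonneg_pos) auto
    from Gamma_real_pos[OF this] show ?thesis
      using assms by (simp add: raney_eq_stable_coeff abs_mult mult.commute)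
  qed
  also have "\<dots> \<le> exp 2 ^ n"
    using assms by (intro abs_raney_le) auto
  finally show ?thesis
    using assms by (simp add: exp_minus field_simps powr_powr [symmetric] powr_realpow power_divide)
qed

definition stable_series :: "real \<Rightarrow> complex \<Rightarrow> real \<Rightarrow> complex" where
  "stable_series \<alpha> q t = (\<Sum>n. of_real (stable_coeff \<alpha> n) * (q * of_real (t powr \<alpha>)) ^ n)"

text \<open>
  The bound \<open>abs_stable_coeff_le\<close> holds for every \<open>R > 0\<close>, so \<open>R\<close> can be chosen, depending on \<open>x\<close>, such that
  the terms are dominated by a multiple of \<open>2\<^bsup>-n\<^esup>\<close>.
\<close>
lemma summable_stable_series:
  assumes "0 < \<alpha>" "\<alpha> \<le> 2"
  shows "summable (\<lambda>n. norm (of_real (stable_coeff \<alpha> n) * x ^ n :: complex))"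
proof -
  define R where "R = (2 * exp 2 * (norm x + 1)) powr (1 / \<alpha>)"
  have "R > 0" using norm_ge_zero[of x] by (simp add: R_def add_nonneg_eq_0_iff)
  have R: "R powr \<alpha> = 2 * exp 2 * (norm x + 1)"
    using assms norm_ge_zero[of x] by (simp add: R_def powr_powr)
  show ?thesis
  proof (rule summable_comparison_test)
    show "summable (\<lambda>n. exp R * (1 / 2) ^ n)" by (intro summable_mult summable_geometric) auto
    have "norm (of_real (stable_coeff \<alpha> n) * x ^ n) \<le> exp R * (1 / 2) ^ n" for n
    proof -
      have "norm (of_real (stable_coeff \<alpha> n) * x ^ n) \<le> exp R * (exp 2 / R powr \<alpha>) ^ n * norm x ^ n"
        using abs_stable_coeff_le[OF assms \<open>R > 0\<close>, of n]
        by (simp add: norm_mult norm_power mult_right_mono)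
      also have "\<dots> = exp R * (exp 2 / R powr \<alpha> * norm x) ^ n"
        by (simp only: power_mult_distrib mult.assoc)
      also have "\<dots> \<le> exp R * (1 / 2) ^ n"
      proof -
        have "norm x + 1 > 0" using norm_ge_zero[of x] by linarith
        hence "exp 2 / R powr \<alpha> * norm x = 1 / 2 * (norm x / (norm x + 1))"
          unfolding R by simp
        also have "\<dots> \<le> 1 / 2 * 1"
          using \<open>norm x + 1 > 0\<close> by (intro mult_left_mono) auto
        finally show ?thesis
          by (intro mult_left_mono power_mono) auto
      qed
      finally show ?thesis .
    qed
    thus "\<exists>N. \<forall>n\<ge>N. norm (norm (of_real (stable_coeff \<alpha> n) * x ^ n)) \<le> exp R * (1 / 2) ^ n"
      by auto
  qed
qed

lemma continuous_on_stable_series: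
  assumes "0 < \<alpha>" "\<alpha> \<le> 2"
  shows "continuous_on {0<..} (stable_series \<alpha> q)"
proof -
  have "isCont (\<lambda>x. \<Sum>n. of_real (stable_coeff \<alpha> n) * x ^ n :: complex) x" for x
    by (intro isCont_powser_converges_everywhere summable_norm_cancel[OF summable_stable_series[OF assms]])
  hence "continuous_on UNIV (\<lambda>x. \<Sum>n. of_real (stable_coeff \<alpha> n) * x ^ n :: complex)"
    by (simp add: continuous_at_imp_continuous_on)
  moreover have "continuous_on {0<..} (\<lambda>t. q * of_real (t powr \<alpha>))"
    by (intro continuous_intros) auto
  ultimately show ?thesis
    unfolding stable_series_def by (rule continuous_on_compose2) auto
qed

text \<open>
  Integrating \<open>t\<^bsup>\<alpha>n\<^esup>\<close> against \<open>exp (- y t)\<close> multiplies the \<open>n\<close>-th coefficient by \<open>\<Gamma>(\<alpha>n + 1)\<close> and so turns it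
  into \<open>raney \<alpha> n\<close>. The entire series becomes a power series with a finite radius of convergence,
  hence the restriction to large \<open>y\<close>.
\<close>
lemma laplace_stable_series:
  assumes \<alpha>: "0 < \<alpha>" "\<alpha> \<le> 2" and q: "norm q \<le> 1" and y: "y > 0" "y powr \<alpha> > exp 2"
  shows "has_bochner_integral lborel (\<lambda>t. indicator {0<..} t *\<^sub>R (exp (- y * t) *\<^sub>R stable_series \<alpha> q t))
           ((\<Sum>n. of_real (raney \<alpha> n) * (q * of_real (y powr - \<alpha>)) ^ n) / of_real y)"
proof -
  define c where "c = (\<lambda>n. of_real (stable_coeff \<alpha> n) * q ^ n)"
  define f where "f = (\<lambda>n t. c n * of_real (indicator {0<..} t * (exp (- y * t) * t powr (\<alpha> * real n))))"
  have monomial: "has_bochner_integral lborel (\<lambda>t. indicator {0<..} t * (exp (- y * t) * t powr (\<alpha> * real n)))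
                    (Gamma (\<alpha> * real n + 1) / y powr (\<alpha> * real n + 1))" for n
    using \<alpha> y by (intro laplace_powr) auto
  have powers: "y powr (\<alpha> * real n + 1) = y / (y powr - \<alpha>) ^ n" for n
    using y by (simp add: powr_add powr_powr powr_minus field_simps flip: powr_realpow)
  have f: "has_bochner_integral lborel (f n) (of_real (raney \<alpha> n) * (q * of_real (y powr - \<alpha>)) ^ n / of_real y)" for n
  proof -
    have "has_bochner_integral lborel (f n) (c n * of_real (Gamma (\<alpha> * real n + 1) / y powr (\<alpha> * real n + 1)))"
      unfolding f_def by (intro has_bochner_integral_mult_right has_bochner_integral_of_real monomial)
    thus ?thesis
      by (simp add: c_def powers raney_eq_stable_coeff \<alpha> power_mult_distrib mult_ac)
  qed
  have norm_f: "has_bochner_integral lborel (\<lambda>t. norm (f n t)) (\<bar>raney \<alpha> n\<bar> * (norm q * y powr - \<alpha>) ^ n / y)" for n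
  proof -
    have "(\<lambda>t. norm (f n t)) = (\<lambda>t. norm (c n) * (indicator {0<..} t * (exp (- y * t) * t powr (\<alpha> * real n))))"
      by (simp add: f_def norm_mult fun_eq_iff)
    moreover have "has_bochner_integral lborel
         (\<lambda>t. norm (c n) * (indicator {0<..} t * (exp (- y * t) * t powr (\<alpha> * real n))))
         (norm (c n) * (Gamma (\<alpha> * real n + 1) / y powr (\<alpha> * real n + 1)))"
      by (intro has_bochner_integral_mult_right monomial)
    moreover have "Gamma (\<alpha> * real n + 1) \<ge> 0"
      using \<alpha> by (intro less_imp_le[OF Gamma_real_pos] add_nonneg_pos) auto
    ultimately show ?thesis
      by (simp add: c_def powers raney_eq_stable_coeff \<alpha> power_mult_distrib mult_ac norm_mult norm_power abs_mult)
  qed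
  have terms: "f n t = (indicator {0<..} t * exp (- y * t)) *\<^sub>R (of_real (stable_coeff \<alpha> n) * (q * of_real (t powr \<alpha>)) ^ n)" for n t
  proof (cases "t > 0")
    case True
    hence "t powr (\<alpha> * real n) = (t powr \<alpha>) ^ n"
      by (simp add: powr_powr flip: powr_realpow)
    thus ?thesis by (simp add: f_def c_def scaleR_conv_of_real power_mult_distrib)
  qed (simp add: f_def)
  have summable_t: "summable (\<lambda>n. norm (f n t))" for t
    unfolding terms norm_scaleR by (intro summable_mult summable_stable_series \<alpha>)
  have summable_int: "summable (\<lambda>n. \<integral>t. norm (f n t) \<partial>lborel)"
  proof (rule summable_comparison_test)
    have "exp 2 * y powr - \<alpha> < 1" using y by (simp add: powr_minus field_simps)
    thus "summable (\<lambda>n. (exp 2 * y powr - \<alpha>) ^ n / y)"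
      by (intro summable_divide summable_geometric) auto
    have "\<bar>raney \<alpha> n\<bar> * (norm q * y powr - \<alpha>) ^ n / y \<le> (exp 2 * y powr - \<alpha>) ^ n / y" for n
    proof -
      have "norm q * y powr - \<alpha> \<le> 1 * y powr - \<alpha>"
        using q by (intro mult_right_mono) auto
      hence "\<bar>raney \<alpha> n\<bar> * (norm q * y powr - \<alpha>) ^ n \<le> exp 2 ^ n * (y powr - \<alpha>) ^ n"
        using abs_raney_le[of \<alpha> n] \<alpha> by (intro mult_mono power_mono) auto
      thus ?thesis using y by (simp add: power_mult_distrib divide_right_mono)
    qed
    thus "\<exists>N. \<forall>n\<ge>N. norm (\<integral>t. norm (f n t) \<partial>lborel) \<le> (exp 2 * y powr - \<alpha>) ^ n / y"
      using norm_f y by (auto simp: has_bochner_integral_iff)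
  qed
  have sum_f: "(\<Sum>n. f n t) = indicator {0<..} t *\<^sub>R (exp (- y * t) *\<^sub>R stable_series \<alpha> q t)" for t
    unfolding terms stable_series_def
    by (subst suminf_scaleR_right [symmetric])
       (auto intro: summable_norm_cancel summable_stable_series \<alpha>)
  have int_f: "integrable lborel (f n)" for n
    using f by (auto simp: has_bochner_integral_iff)
  have "integrable lborel (\<lambda>t. \<Sum>n. f n t)"
    by (intro integrable_suminf int_f summable_int) (use summable_t in auto)
  moreover have sums: "(\<lambda>n. \<integral>t. f n t \<partial>lborel) sums (\<integral>t. (\<Sum>n. f n t) \<partial>lborel)"
    by (intro sums_integral int_f summable_int) (use summable_t in auto)
  moreover have "(\<Sum>n. of_real (raney \<alpha> n) * (q * of_real (y powr - \<alpha>)) ^ n) / of_real y =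
                 (\<integral>t. (\<Sum>n. f n t) \<partial>lborel)"
  proof -
    have "(\<lambda>n. (\<integral>t. f n t \<partial>lborel) * of_real y) sums ((\<integral>t. (\<Sum>n. f n t) \<partial>lborel) * of_real y)"
      using sums by (rule sums_mult2)
    moreover have "(\<integral>t. f n t \<partial>lborel) * of_real y = of_real (raney \<alpha> n) * (q * of_real (y powr - \<alpha>)) ^ n" for n
      using f[of n] y by (simp add: has_bochner_integral_iff)
    ultimately show ?thesis using y by (simp add: sums_iff)
  qed
  ultimately show ?thesis unfolding sum_f by (simp add: has_bochner_integral_iff)
qed

section \<open>The functional equation of the Cauchy transform on the imaginary axis\<close>

text \<open>
  With \<open>u = \<i>y G(\<i>y)\<close>, conjugated, the defining equation \<open>z = 1/w - e\<^bsup>\<pi>\<i>\<alpha>\<rho>\<^esup> w\<^bsup>\<alpha>-1\<^esup>\<close> at \<open>z = \<i>y\<close> becomes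
  \<open>u = 1 + x u\<^sup>\<alpha>\<close> with \<open>x = - e\<^bsup>\<pi>\<i>\<alpha>(1/2-\<rho>)\<^esup> y\<^bsup>-\<alpha>\<^esup>\<close>, the conjugate of \<open>- e\<^bsup>\<pi>\<i>\<alpha>\<rho>\<^esup> (\<i>y)\<^bsup>-\<alpha>\<^esup>\<close>. Splitting the power of
  \<open>F = \<i>y / cnj u\<close> into powers of its factors is legitimate because \<open>Re u > 0\<close>: then the arguments of \<open>\<i>\<close>
  and of \<open>u\<close> add up to less than \<open>\<pi>\<close> in absolute value.
\<close>
lemma free_stable_functional_equation:
  assumes "free_stable_distribution \<alpha> \<rho> \<nu>" and y: "y > 0"
  defines "u \<equiv> of_real y * (CLINT x|\<nu>. 1 / (of_real y - \<i> * of_real x))"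
  assumes u: "Re u > 0"
  shows "(u - 1) * u powr - of_real \<alpha> =
         - exp (complex_of_real pi * \<i> * of_real \<alpha> * of_real (1 / 2 - \<rho>)) * of_real (y powr - \<alpha>)"
proof -
  define e where "e = exp (complex_of_real pi * \<i> * of_real \<alpha> * of_real \<rho>)"
  have [simp]: "u \<noteq> 0" using u by auto
  have cauchy: "cauchy_transform \<nu> (\<i> * of_real y) = cnj u / (\<i> * of_real y)"
  proof -
    have "cnj u = of_real y * (CLINT x|\<nu>. 1 / (of_real y + \<i> * of_real x))"
      unfolding u_def complex_cnj_mult Bochner_Integration.integral_cnj [symmetric]
      by (simp del: Bochner_Integration.integral_cnj)
    also have "(\<lambda>x. 1 / (of_real y + \<i> * of_real x)) = (\<lambda>x. \<i> * (1 / (\<i> * of_real y - of_real x)))"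
    proof
      fix x :: real
      have "\<i> * of_real y - of_real x = \<i> * (of_real y + \<i> * of_real x)"
        by (simp add: algebra_simps)
      thus "1 / (of_real y + \<i> * of_real x) = \<i> * (1 / (\<i> * of_real y - of_real x))"
        by simp
    qed
    also have "(CLINT x|\<nu>. \<i> * (1 / (\<i> * of_real y - of_real x))) = \<i> * cauchy_transform \<nu> (\<i> * of_real y)"
      unfolding cauchy_transform_def by (rule integral_mult_right_zero)
    finally show ?thesis using y by simp
  qed
  define F where "F = \<i> * of_real y / cnj u"
  have [simp]: "F \<noteq> 0" using y by (simp add: F_def)
  have "F - e * F powr (1 - of_real \<alpha>) = \<i> * of_real y"
    using assms(1) y
    by (auto simp: free_stable_distribution_def has_voiculescu_transform_def stable_voiculescu_def
                   cauchy F_def e_def Let_def dest!: spec[of _ "\<i> * of_real y"])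
  also have "F powr (1 - of_real \<alpha>) = F * F powr - of_real \<alpha>"
    using powr_add[of F 1 "- of_real \<alpha>"] by simp
  also have "\<i> * of_real y = F * cnj u"
    by (simp add: F_def)
  finally have "F * (1 - e * F powr - of_real \<alpha>) = F * cnj u"
    by (simp add: algebra_simps)
  hence "cnj (cnj u) = cnj (1 - e * F powr - of_real \<alpha>)"
    by simp
  hence u_eq: "u - 1 = - (cnj e * cnj (F powr - of_real \<alpha>))"
    by simp

  have Im_Ln: "\<bar>Im (Ln u)\<bar> < pi / 2" using Re_Ln_pos_lt[OF \<open>u \<noteq> 0\<close>] u by simp
  have "F = exp (of_real (ln y) + \<i> * of_real (pi / 2) - cnj (Ln u))"
  proof -
    have "exp (\<i> * of_real (pi / 2)) = \<i>"
      using cis_conv_exp [of "pi / 2"] by simp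
    moreover have "exp (cnj (Ln u)) = cnj u"
      by (simp flip: exp_cnj)
    ultimately show ?thesis
      using y by (simp add: F_def exp_add exp_diff exp_of_real)
  qed
  moreover have "Ln (exp (of_real (ln y) + \<i> * of_real (pi / 2) - cnj (Ln u))) =
                 of_real (ln y) + \<i> * of_real (pi / 2) - cnj (Ln u)"
    using Im_Ln by (intro Ln_exp) auto
  ultimately have Ln_F: "Ln F = of_real (ln y) + \<i> * of_real (pi / 2) - cnj (Ln u)"
    by simp
  have "cnj e * cnj (F powr - of_real \<alpha>) * u powr - of_real \<alpha> =
        exp (- (of_real pi * \<i> * of_real \<alpha> * of_real \<rho>) + - of_real \<alpha> * cnj (Ln F) + - of_real \<alpha> * Ln u)"
    by (simp add: e_def powr_def exp_cnj flip: exp_add)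
  also have "- (of_real pi * \<i> * of_real \<alpha> * of_real \<rho>) + - of_real \<alpha> * cnj (Ln F) + - of_real \<alpha> * Ln u =
             of_real pi * \<i> * of_real \<alpha> * of_real (1 / 2 - \<rho>) + of_real (- \<alpha> * ln y)"
    unfolding Ln_F by (simp add: algebra_simps)
  also have "exp \<dots> = exp (complex_of_real pi * \<i> * of_real \<alpha> * of_real (1 / 2 - \<rho>)) * of_real (y powr - \<alpha>)"
    using y by (simp only: exp_add exp_of_real) (simp add: powr_def)
  finally show ?thesis unfolding u_eq by (simp add: mult_ac)
qed

section \<open>The characteristic function\<close>

theorem theorem3:
  fixes \<alpha> \<rho> z :: real and \<nu> :: "real measure"
  assumes "(\<alpha>, \<rho>) \<in> admissible"
    and "free_stable_distribution \<alpha> \<rho> \<nu>"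
    and "z > 0"
  shows "(\<lambda>n. (- 1) ^ n *
            (exp (complex_of_real pi * \<i> * of_real \<alpha> * of_real (1 / 2 - \<rho>) * of_nat n) *
             of_real (rGamma (2 + (\<alpha> - 1) * real n)) / fact n) *
            of_real (z powr (\<alpha> * real n)))
         sums char \<nu> z"
proof -
  have \<alpha>: "0 < \<alpha>" "\<alpha> \<le> 2" using assms(1) by (auto simp: admissible_def)
  interpret \<nu>: real_distribution \<nu>
    using assms(2) by (simp add: free_stable_distribution_def)
  define q where "q = - exp (complex_of_real pi * \<i> * of_real \<alpha> * of_real (1 / 2 - \<rho>))"
  have q: "norm q = 1"
    by (simp add: q_def)
  define U where "U = (\<lambda>y. of_real y * (CLINT x|\<nu>. 1 / (of_real y - \<i> * of_real x)))"

  have "\<forall>\<^sub>F y in at_top. dist (U y) 1 < 1 / 64"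
    using \<nu>.cauchy_transform_tendsto unfolding U_def by (rule tendstoD) simp
  moreover have "\<forall>\<^sub>F y in at_top. y powr \<alpha> > exp 2"
    using eventually_gt_at_top[of "exp (2 / \<alpha>)"]
  proof eventually_elim
    case (elim y)
    hence "exp (2 / \<alpha>) powr \<alpha> < y powr \<alpha>"
      using \<alpha> by (intro powr_less_mono2) auto
    thus ?case using \<alpha> by (simp add: powr_def)
  qed
  ultimately obtain Y0 where Y0: "\<And>y. y \<ge> Y0 \<Longrightarrow> dist (U y) 1 < 1 / 64 \<and> y powr \<alpha> > exp 2"
    unfolding eventually_at_top_linorder by (metis max.bounded_iff)
  define Y where "Y = max Y0 1"

  \<comment> \<open>For large \<open>y\<close> both Laplace transforms are \<open>U y / y\<close>.\<close>
  have "char \<nu> z = stable_series \<alpha> q z"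
  proof (rule laplace_unique[OF _ _ _ _ assms(3)])
    show "continuous_on {0<..} (char \<nu>)"
      by (intro continuous_at_imp_continuous_on ballI \<nu>.isCont_char)
    show "continuous_on {0<..} (stable_series \<alpha> q)"
      using \<alpha> by (rule continuous_on_stable_series)
  next
    fix y assume "y \<ge> Y"
    hence y: "y > 0" "y powr \<alpha> > exp 2" and close: "norm (U y - 1) \<le> 1 / 64"
      using Y0[of y] by (auto simp: Y_def dist_norm)
    have "Re (U y) > 0"
      using close abs_Re_le_cmod[of "U y - 1"] by simp
    from free_stable_functional_equation[OF assms(2) y(1) this[unfolded U_def]]
    have eq: "(U y - 1) * U y powr - of_real \<alpha> = q * of_real (y powr - \<alpha>)"
      by (simp add: U_def q_def)
    from raney_series_inverse[OF _ \<alpha>(2) close] \<alpha>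
    have "(\<lambda>n. of_real (raney \<alpha> n) * (q * of_real (y powr - \<alpha>)) ^ n) sums U y"
      by (simp add: eq)
    hence "(\<Sum>n. of_real (raney \<alpha> n) * (q * of_real (y powr - \<alpha>)) ^ n) = U y"
      by (rule sums_unique [symmetric])
    thus "has_bochner_integral lborel (\<lambda>t. indicator {0<..} t *\<^sub>R (exp (- y * t) *\<^sub>R stable_series \<alpha> q t)) (U y / of_real y)"
      using laplace_stable_series[OF \<alpha> _ y, of q] q by simp
    show "has_bochner_integral lborel (\<lambda>t. indicator {0<..} t *\<^sub>R (exp (- y * t) *\<^sub>R char \<nu> t)) (U y / of_real y)"
      using \<nu>.laplace_char[OF y(1)] y by (simp add: U_def)
  qed
  moreover have "(\<lambda>n. of_real (stable_coeff \<alpha> n) * (q * of_real (z powr \<alpha>)) ^ n) sums stable_series \<alpha> q z"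
    unfolding stable_series_def
    by (intro summable_sums summable_norm_cancel[OF summable_stable_series[OF \<alpha>]])
  moreover have "of_real (stable_coeff \<alpha> n) * (q * of_real (z powr \<alpha>)) ^ n =
        (- 1) ^ n * (exp (complex_of_real pi * \<i> * of_real \<alpha> * of_real (1 / 2 - \<rho>) * of_nat n) *
           of_real (rGamma (2 + (\<alpha> - 1) * real n)) / fact n) * of_real (z powr (\<alpha> * real n))" for n
  proof -
    define x where "x = complex_of_real pi * \<i> * of_real \<alpha> * of_real (1 / 2 - \<rho>)"
    have "q ^ n = (- 1) ^ n * exp (x * of_nat n)"
      unfolding q_def x_def [symmetric] by (simp add: power_minus[of "exp x"] mult.commute[of x] exp_of_nat_mult)
    moreover have "(z powr \<alpha>) ^ n = z powr (\<alpha> * real n)"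
      using assms(3) by (simp add: powr_powr flip: powr_realpow)
    ultimately show ?thesis
      unfolding x_def [symmetric] by (simp add: stable_coeff_def power_mult_distrib flip: of_real_power)
  qed
  ultimately show ?thesis by simp
qed

end
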